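(* Let $X$ be a complete metric space with metric $d$, $T\colon X \to X$ a mapping, and $R$ a nonempty subset of $X \times X$. Let $x \in X$. Suppose that (1) $(u,v) \in R$ and $(v,w) \in R$ imply $(u,w) \in R$; (2) $(x,Tx) \in R$; (3) $(Tu,Tv) \in R$ for all $(u,v)\in R$; (4) for any $\epsilon >0$ there exists $\delta >0$ such that $(u,v) \in R$ and $\epsilon \leq d (u, v) < \epsilon + \delta$ imply $d(Tu, Tv) < \epsilon$; (5) if $\{x_n \}_{n\in\mathbb{N}}$ is a sequence in $X$ such that $x_n \to y$ (with $y \in X$) and $(x_n, x_{n+1}) \in R$ for all $n \in \mathbb{N}$, then there exists a subsequence $\{x_{n_k}\}$ of $\{x_n\}$ such that $T x_{n_k} \to Ty$ as $k \to \infty$. Then $\{T^n x\}$ converges to a fixed point of $T$; in particular, $T$ has a fixed point. Moreover, suppose in addition that (6) $(x,y) \in R$ for all $y \in X$; (7) $R$ is closed in $X\times X$. Then $T$ has a unique fixed point.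
   Context: $\mathbb{N}$ denotes the set of positive integers; $T^n$ denotes the $n$-th iterate of $T$. *)

theory Defs
  imports "HOL-Analysis.Analysis"
begin

end

theory Submission
  imports Defs
begin

text \<open>
  The hypothesis on distances is a Meir--Keeler condition, required only for pairs in \<open>R\<close>.
  It forces \<open>dist (T u) (T v) < dist u v\<close> for distinct \<open>R\<close>-related points, so the distances
  \<open>dist (T\<^sup>n u) (T\<^sup>n v)\<close> decrease along \<open>R\<close>-related orbits. Their limit cannot be some
  \<open>\<epsilon> > 0\<close>, since a distance just above \<open>\<epsilon>\<close> is pushed strictly below \<open>\<epsilon>\<close> by the next step;
  hence \<open>R\<close>-related orbits are asymptotic (\<open>related_orbits_asymptotic\<close>).

  Both halves of the theorem rest on this. Applied to \<open>(x, T x)\<close> it says that the steps of the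
  orbit of \<open>x\<close> tend to \<open>0\<close>. Transitivity of \<open>R\<close> relates any earlier point of the orbit to any
  later one, and the Meir--Keeler condition then keeps the whole rest of the orbit within
  \<open>\<epsilon> + \<delta>\<close> of its start, as soon as single steps are shorter than \<open>\<delta>\<close>; so the orbit is Cauchy
  (\<open>orbit_Cauchy\<close>). Its limit \<open>y\<close> is fixed because, along the subsequence provided by the weak
  continuity assumption, \<open>T\<close> of the orbit tends to \<open>T y\<close>, while as a shifted piece of the orbit
  it tends to \<open>y\<close>. For uniqueness, \<open>x\<close> is related to any fixed point \<open>z\<close>, so the orbit of \<open>x\<close>
  is asymptotic to the constant orbit of \<open>z\<close> and therefore converges to \<open>z\<close>.
\<close>

definition meir_keeler_on :: "('a::metric_space \<times> 'a) set \<Rightarrow> ('a \<Rightarrow> 'a) \<Rightarrow> bool" where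
  "meir_keeler_on R T \<longleftrightarrow>
     (\<forall>\<epsilon>>0. \<exists>\<delta>>0. \<forall>u v. (u, v) \<in> R \<and> \<epsilon> \<le> dist u v \<and> dist u v < \<epsilon> + \<delta>
        \<longrightarrow> dist (T u) (T v) < \<epsilon>)"

text \<open>For distinct points the condition applies with \<open>\<epsilon> = dist u v\<close>, its own lower bound.\<close>
lemma meir_keeler_on_nonexpansive:
  assumes "meir_keeler_on R T" and "(u, v) \<in> R"
  shows "dist (T u) (T v) \<le> dist u v"
proof (cases "u = v")
  case False
  then have "dist u v > 0"
    by simp
  with assms(1) obtain \<delta> where "\<delta> > 0"
    and "\<And>a b. (a, b) \<in> R \<Longrightarrow> dist u v \<le> dist a b \<Longrightarrow> dist a b < dist u v + \<delta>
           \<Longrightarrow> dist (T a) (T b) < dist u v"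
    unfolding meir_keeler_on_def by meson
  from this(2)[OF assms(2)] \<open>\<delta> > 0\<close> show ?thesis
    by simp
qed simp

lemma related_orbits:
  assumes "\<And>u v. (u, v) \<in> R \<Longrightarrow> (T u, T v) \<in> R" and "(u, v) \<in> R"
  shows "((T ^^ n) u, (T ^^ n) v) \<in> R"
  by (induction n) (use assms in auto)

text \<open>
  The distances decrease to their infimum \<open>e\<close>. If \<open>e\<close> were positive, some distance would lie in
  the window from \<open>e\<close> to \<open>e + \<delta>\<close>, and the next one would fall below the infimum.
\<close>
lemma related_orbits_asymptotic:
  assumes mk: "meir_keeler_on R T"
    and invariant: "\<And>u v. (u, v) \<in> R \<Longrightarrow> (T u, T v) \<in> R"
    and uv: "(u, v) \<in> R"
  shows "(\<lambda>n. dist ((T ^^ n) u) ((T ^^ n) v)) \<longlonglongrightarrow> 0"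
proof -
  define D where "D = (\<lambda>n. dist ((T ^^ n) u) ((T ^^ n) v))"
  have related: "((T ^^ n) u, (T ^^ n) v) \<in> R" for n
    using related_orbits[where T = T, OF invariant uv] .
  have "decseq D"
    unfolding D_def decseq_Suc_iff
    using meir_keeler_on_nonexpansive[OF mk related] by simp
  then obtain e where lim: "D \<longlonglongrightarrow> e" and below: "\<And>n. e \<le> D n"
    using decseq_convergent[of D 0] by (auto simp: D_def)
  have "e \<ge> 0"
    using LIMSEQ_le_const[OF lim, of 0] by (auto simp: D_def)
  moreover have "\<not> e > 0"
  proof
    assume "e > 0"
    with mk obtain \<delta> where "\<delta> > 0"
      and \<delta>: "\<And>a b. (a, b) \<in> R \<Longrightarrow> e \<le> dist a b \<Longrightarrow> dist a b < e + \<delta>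
                \<Longrightarrow> dist (T a) (T b) < e"
      unfolding meir_keeler_on_def by meson
    from lim \<open>\<delta> > 0\<close> have "eventually (\<lambda>n. D n < e + \<delta>) sequentially"
      by (intro order_tendstoD(2)[of D e]) auto
    then obtain n where "D n < e + \<delta>"
      by (auto simp: eventually_sequentially)
    then have "D (Suc n) < e"
      using \<delta>[OF related[of n]] below[of n] by (simp add: D_def)
    with below[of "Suc n"] show False
      by simp
  qed
  ultimately have "e = 0"
    by simp
  with lim show ?thesis
    by (simp add: D_def)
qed

lemma orbit_increasing_related:
  assumes "trans R" and "\<And>u v. (u, v) \<in> R \<Longrightarrow> (T u, T v) \<in> R" and "(x, T x) \<in> R"
  shows "((T ^^ n) x, (T ^^ (n + Suc k)) x) \<in> R"
proof -
  have step: "((T ^^ m) x, (T ^^ Suc m) x) \<in> R" for m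
    using related_orbits[where T = T, OF assms(2,3)] by (simp add: funpow_swap1)
  show ?thesis
  proof (induction k)
    case 0
    show ?case
      using step[of n] by simp
  next
    case (Suc k)
    then show ?case
      using transD[OF assms(1) Suc step[of "n + Suc k"]] by simp
  qed
qed

text \<open>
  Once single steps are shorter than \<open>\<delta>\<close>, the bound \<open>\<epsilon> + \<delta>\<close> on \<open>dist x\<^sub>n x\<^sub>n\<^sub>+\<^sub>k\<close> propagates from
  \<open>k\<close> to \<open>k + 1\<close>: applying \<open>T\<close> to both points brings the distance below \<open>\<epsilon>\<close>, and one step from
  \<open>x\<^sub>n\<close> to \<open>x\<^sub>n\<^sub>+\<^sub>1\<close> adds less than \<open>\<delta>\<close>.
\<close>
lemma orbit_Cauchy:
  assumes mk: "meir_keeler_on R T" and "trans R"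
    and invariant: "\<And>u v. (u, v) \<in> R \<Longrightarrow> (T u, T v) \<in> R" and xTx: "(x, T x) \<in> R"
  shows "Cauchy (\<lambda>n. (T ^^ n) x)"
proof (rule metric_CauchyI)
  fix r :: real
  assume "r > 0"
  define \<epsilon> where "\<epsilon> = r / 2"
  have "\<epsilon> > 0"
    using \<open>r > 0\<close> by (simp add: \<epsilon>_def)
  with mk obtain \<delta>' where "\<delta>' > 0"
    and \<delta>': "\<And>a b. (a, b) \<in> R \<Longrightarrow> \<epsilon> \<le> dist a b \<Longrightarrow> dist a b < \<epsilon> + \<delta>'
              \<Longrightarrow> dist (T a) (T b) < \<epsilon>"
    unfolding meir_keeler_on_def by meson
  \<comment> \<open>Shrinking \<open>\<delta>'\<close> preserves its property and makes the final bound \<open>\<epsilon> + \<delta>\<close> at most \<open>r\<close>.\<close>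
  define \<delta> where "\<delta> = min \<delta>' \<epsilon>"
  have "\<delta> > 0" "\<epsilon> + \<delta> \<le> r"
    using \<open>\<delta>' > 0\<close> \<open>\<epsilon> > 0\<close> by (auto simp: \<delta>_def \<epsilon>_def)
  have contract: "dist (T a) (T b) < \<epsilon>" if "(a, b) \<in> R" "dist a b < \<epsilon> + \<delta>" for a b
    using that \<delta>'[of a b] meir_keeler_on_nonexpansive[OF mk, of a b]
    by (cases "\<epsilon> \<le> dist a b") (auto simp: \<delta>_def)
  have "eventually (\<lambda>n. dist ((T ^^ n) x) ((T ^^ n) (T x)) < \<delta>) sequentially"
    using order_tendstoD(2)[OF related_orbits_asymptotic[OF mk invariant xTx] \<open>\<delta> > 0\<close>] .
  then obtain N where N: "\<And>n. n \<ge> N \<Longrightarrow> dist ((T ^^ n) x) ((T ^^ Suc n) x) < \<delta>"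
    unfolding eventually_sequentially by (auto simp: funpow_swap1)
  have ahead: "dist ((T ^^ n) x) ((T ^^ (n + k)) x) < r" if "n \<ge> N" for n k
  proof -
    have "dist ((T ^^ n) x) ((T ^^ (n + k)) x) < \<epsilon> + \<delta>"
    proof (induction k)
      case 0
      show ?case
        using \<open>\<epsilon> > 0\<close> \<open>\<delta> > 0\<close> by simp
    next
      case (Suc k)
      have "dist ((T ^^ Suc n) x) ((T ^^ (n + Suc k)) x) < \<epsilon>"
      proof (cases k)
        case 0
        then show ?thesis
          using \<open>\<epsilon> > 0\<close> by simp
      next
        case (Suc j)
        then have "((T ^^ n) x, (T ^^ (n + k)) x) \<in> R"
          using orbit_increasing_related[where T = T, OF \<open>trans R\<close> invariant xTx] by blast
        from contract[OF this Suc.IH] show ?thesis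
          by simp
      qed
      moreover have "dist ((T ^^ n) x) ((T ^^ Suc n) x) < \<delta>"
        using N[OF \<open>n \<ge> N\<close>] .
      ultimately show ?case
        using dist_triangle[of "(T ^^ n) x" "(T ^^ (n + Suc k)) x" "(T ^^ Suc n) x"]
        by linarith
    qed
    with \<open>\<epsilon> + \<delta> \<le> r\<close> show ?thesis
      by simp
  qed
  have "dist ((T ^^ m) x) ((T ^^ n) x) < r" if "m \<ge> N" "n \<ge> N" for m n
  proof (cases "m \<le> n")
    case True
    then show ?thesis
      using ahead[OF \<open>m \<ge> N\<close>, of "n - m"] by simp
  next
    case False
    then show ?thesis
      using ahead[OF \<open>n \<ge> N\<close>, of "m - n"] by (simp add: dist_commute)
  qed
  then show "\<exists>M. \<forall>m\<ge>M. \<forall>n\<ge>M. dist ((T ^^ m) x) ((T ^^ n) x) < r"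
    by blast
qed

theorem theorem4p1:
  fixes T :: "'a::complete_space \<Rightarrow> 'a"
    and R :: "('a \<times> 'a) set"
    and x :: 'a
  assumes R_nonempty: "R \<noteq> {}"
    and h1: "\<forall>u v w. (u, v) \<in> R \<and> (v, w) \<in> R \<longrightarrow> (u, w) \<in> R"
    and h2: "(x, T x) \<in> R"
    and h3: "\<forall>u v. (u, v) \<in> R \<longrightarrow> (T u, T v) \<in> R"
    and h4: "\<forall>\<epsilon>>0. \<exists>\<delta>>0. \<forall>u v. (u, v) \<in> R \<and> \<epsilon> \<le> dist u v \<and> dist u v < \<epsilon> + \<delta>
               \<longrightarrow> dist (T u) (T v) < \<epsilon>"
    and h5: "\<forall>(s :: nat \<Rightarrow> 'a) y. s \<longlonglongrightarrow> y \<and> (\<forall>n. (s n, s (Suc n)) \<in> R)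
               \<longrightarrow> (\<exists>r :: nat \<Rightarrow> nat. strict_mono r \<and> (\<lambda>k. T (s (r k))) \<longlonglongrightarrow> T y)"
  shows "(\<exists>y. T y = y \<and> (\<lambda>n. (T ^^ n) x) \<longlonglongrightarrow> y) \<and>
         ((\<forall>y. (x, y) \<in> R) \<and> closed R \<longrightarrow> (\<exists>!y. T y = y))"
proof (intro conjI impI)
  have mk: "meir_keeler_on R T"
    using h4 unfolding meir_keeler_on_def .
  have "trans R"
    using h1 by (blast intro: transI)
  have invariant: "(T u, T v) \<in> R" if "(u, v) \<in> R" for u v
    using h3 that by blast
  obtain y where lim: "(\<lambda>n. (T ^^ n) x) \<longlonglongrightarrow> y"
    using Cauchy_convergent[OF orbit_Cauchy[OF mk \<open>trans R\<close> invariant h2]]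
    unfolding convergent_def by blast
  have "((T ^^ n) x, (T ^^ Suc n) x) \<in> R" for n
    using orbit_increasing_related[where T = T, OF \<open>trans R\<close> invariant h2, of n 0] by simp
  with lim h5 obtain r :: "nat \<Rightarrow> nat" where "strict_mono r"
    and to_Ty: "(\<lambda>k. T ((T ^^ r k) x)) \<longlonglongrightarrow> T y"
    by meson
  have "(\<lambda>k. T ((T ^^ r k) x)) \<longlonglongrightarrow> y"
    using LIMSEQ_subseq_LIMSEQ[OF LIMSEQ_Suc[OF lim] \<open>strict_mono r\<close>] by (simp add: o_def)
  with to_Ty have fixed: "T y = y"
    by (rule LIMSEQ_unique)
  with lim show "\<exists>y. T y = y \<and> (\<lambda>n. (T ^^ n) x) \<longlonglongrightarrow> y"
    by blast
  assume from_x: "(\<forall>y. (x, y) \<in> R) \<and> closed R"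
  have "z = y" if "T z = z" for z
  proof -
    have "(T ^^ n) z = z" for n
      by (induction n) (use that in auto)
    then have "(\<lambda>n. dist ((T ^^ n) x) z) \<longlonglongrightarrow> 0"
      using related_orbits_asymptotic[OF mk invariant, of x z] from_x by simp
    then have "(\<lambda>n. (T ^^ n) x) \<longlonglongrightarrow> z"
      by (simp add: tendsto_dist_iff[of _ z])
    then show ?thesis
      using lim by (rule LIMSEQ_unique)
  qed
  with fixed show "\<exists>!y. T y = y"
    by blast
qed

end
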